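(* The exponential generating function $\mathsf{F}(t)=\sum_{n=0}^\infty \mathcal{F}_n\frac{t^n}{n!}$ of the Fibonacci-Fubini numbers is given by $$\mathsf{F}(t)= \frac{1}{\sqrt{5}}\left(\alpha e^{\left(e^{t}-1\right)\alpha}-\beta e^{\left(e^{t}-1\right)\beta}\right).$$
   Context: $\alpha=(1+\sqrt5)/2$ and $\beta=(1-\sqrt5)/2$. The identity is one of formal power series in $t$. A permutation $\sigma=\sigma_1\cdots\sigma_k$ of $\{1,\dots,k\}$ is a Fibonacci permutation if $|\sigma_i-i|\le 1$ for every $i$. For a set partition of $[n]=\{1,\dots,n\}$ into non-empty blocks $B_1|B_2|\cdots|B_k$, the blocks are always listed so that $\min B_1<\min B_2<\cdots<\min B_k$. A Fibonacci ordered partition of $[n]$ is an arrangement $B_{\sigma_1}|B_{\sigma_2}|\cdots|B_{\sigma_k}$ where $B_1|\cdots|B_k$ is a partition of $[n]$ (any number $k$ of blocks) and $\sigma$ is a Fibonacci permutation of $\{1,\dots,k\}$. The Fibonacci-Fubini number $\mathcal{F}_n$ is the total number of Fibonacci ordered partitions of $[n]$ (for $n=0$ the empty partition with $k=0$ blocks is counted once, so $\mathcal{F}_0=1$). *)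

theory Defs
  imports
    Complex_Main
    "HOL-Library.Disjoint_Sets"
    "HOL-Combinatorics.Permutations"
    "HOL-Computational_Algebra.Formal_Power_Series"
begin

definition golden_alpha :: real where
  "golden_alpha = (1 + sqrt 5) / 2"

definition golden_beta :: real where
  "golden_beta = (1 - sqrt 5) / 2"

definition fibonacci_permutation :: "nat \<Rightarrow> (nat \<Rightarrow> nat) \<Rightarrow> bool" where
  "fibonacci_permutation k \<sigma> \<longleftrightarrow>
     \<sigma> permutes {1..k} \<and> (\<forall>i\<in>{1..k}. \<bar>int (\<sigma> i) - int i\<bar> \<le> 1)"

text \<open>A set partition of \<open>{1..n}\<close>, given as the list of its blocks in increasing order of
  their minima. The strict ordering also forces the list to be free of repetitions.\<close>

definition block_listing :: "nat \<Rightarrow> nat set list \<Rightarrow> bool" where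
  "block_listing n Bs \<longleftrightarrow>
     partition_on {1..n} (set Bs) \<and> sorted_wrt (\<lambda>A B. Min A < Min B) Bs"

text \<open>Permutations act on the positions \<open>1, \<dots>, k\<close>, whereas list positions start
  at \<open>0\<close>; hence the shift by one.\<close>

definition arrange :: "(nat \<Rightarrow> nat) \<Rightarrow> 'a list \<Rightarrow> 'a list" where
  "arrange \<sigma> Bs = map (\<lambda>i. Bs ! (\<sigma> i - 1)) [1..<Suc (length Bs)]"

definition fibonacci_ordered_partitions :: "nat \<Rightarrow> nat set list set" where
  "fibonacci_ordered_partitions n =
     {arrange \<sigma> Bs | \<sigma> Bs. block_listing n Bs \<and> fibonacci_permutation (length Bs) \<sigma>}"

definition fibonacci_fubini :: "nat \<Rightarrow> nat" where
  "fibonacci_fubini n = card (fibonacci_ordered_partitions n)"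

definition fibonacci_fubini_egf :: "real fps" where
  "fibonacci_fubini_egf = Abs_fps (\<lambda>n. of_nat (fibonacci_fubini n) / fact n)"

end

theory Submission
  imports Defs
begin

text \<open>Decomposing a partition by the block containing a fixed element \<open>x\<close> gives, for the exponential
  generating function \<open>G\<^sub>k\<close> of partitions into \<open>k\<close> blocks, \<open>G\<^sub>k\<^sub>+\<^sub>1' = e\<^sup>t G\<^sub>k\<close>, whence
  \<open>G\<^sub>k = (e\<^sup>t - 1)\<^sup>k / k!\<close>. Fibonacci permutations either fix the last point or swap the last two,
  so their number satisfies the Fibonacci recurrence and equals
  \<open>(\<alpha>\<^sup>k\<^sup>+\<^sup>1 - \<beta>\<^sup>k\<^sup>+\<^sup>1) / \<surd>5\<close>. Summing the product of both counts over \<open>k\<close> yields the two exponentials.\<close>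

section \<open>Set partitions with a fixed number of blocks\<close>

unbundle fps_syntax

text \<open>The block of \<open>x\<close> is \<open>insert x B\<close> for an arbitrary, possibly
  empty, \<open>B\<close> inside \<open>A\<close>; deleting it leaves a partition of
  \<open>A - B\<close> with one block fewer. The sum counts the pairs \<open>(B, P)\<close> of this
  bijection.\<close>

lemma card_partition_on_insert:
  assumes "finite A" "x \<notin> A"
  shows "card {P. partition_on (insert x A) P \<and> card P = Suc k} =
    (\<Sum>B\<in>Pow A. card {P. partition_on (A - B) P \<and> card P = k})"
proof -
  let ?S = "SIGMA B:Pow A. {P. partition_on (A - B) P \<and> card P = k}"
  let ?f = "\<lambda>(B, P). insert (insert x B) P"
  have x_notin: "x \<notin> \<Union>P" if "partition_on (A - B) P" for B P
    using that assms(2) by (auto simp: partition_on_def)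
  have "inj_on ?f ?S"
  proof (rule inj_onI, clarify)
    fix B P C Q
    assume B: "B \<subseteq> A" "partition_on (A - B) P" and C: "C \<subseteq> A" "partition_on (A - C) Q"
      and eq: "insert (insert x B) P = insert (insert x C) Q"
    \<comment> \<open>No block of \<open>P\<close> or \<open>Q\<close> contains \<open>x\<close>, so
      on either side the inserted block is recognised as the one containing
      \<open>x\<close>.\<close>
    have P: "insert x D \<notin> P" and Q: "insert x D \<notin> Q" for D
      using x_notin[OF B(2)] x_notin[OF C(2)] by auto
    have "insert x B = insert x C"
      using eq Q by blast
    moreover have "x \<notin> B" "x \<notin> C"
      using B C assms by auto
    ultimately have "B = C"
      by (simp add: insert_ident)
    moreover have "P = Q"
      using eq P[of B] Q[of B] by (simp add: \<open>B = C\<close> insert_ident)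
    ultimately show "B = C \<and> P = Q" ..
  qed
  moreover have "?f ` ?S = {P. partition_on (insert x A) P \<and> card P = Suc k}"
  proof (intro equalityI subsetI)
    fix R assume "R \<in> ?f ` ?S"
    then obtain B P where R: "R = insert (insert x B) P"
      and B: "B \<subseteq> A" and P: "partition_on (A - B) P" "card P = k"
      by auto
    have "disjnt (insert x B) (\<Union>P)"
      using P assms(2) by (auto simp: disjnt_iff partition_on_def)
    moreover have "insert x A - insert x B = A - B"
      using assms(2) by auto
    ultimately have "partition_on (insert x A) R"
      using B P by (auto simp: R partition_on_insert)
    moreover have "finite P" "insert x B \<notin> P"
      using finite_elements[OF _ P(1)] assms(1) x_notin[OF P(1)] by auto
    ultimately show "R \<in> {P. partition_on (insert x A) P \<and> card P = Suc k}"
      using P by (simp add: R)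
  next
    fix R assume "R \<in> {P. partition_on (insert x A) P \<and> card P = Suc k}"
    then have R: "partition_on (insert x A) R" "card R = Suc k"
      by auto
    then obtain b where b: "b \<in> R" "x \<in> b"
      using partition_onD1 by blast
    \<comment> \<open>The preimage of \<open>R\<close>: the block containing \<open>x\<close>,
      stripped of \<open>x\<close>, and the remaining blocks.\<close>
    let ?B = "b - {x}" and ?P = "R - {b}"
    have "disjnt b (\<Union>?P)"
      using partition_onD2[OF R(1)] b(1) by (auto simp: pairwise_def disjnt_iff)
    moreover have "insert b ?P = R"
      using b by auto
    ultimately have "partition_on (insert x A - b) ?P" and "b \<subseteq> insert x A"
      using partition_on_insert[of b ?P "insert x A"] R(1) by auto
    moreover have "insert x A - b = A - ?B"
      using b assms(2) by auto
    ultimately have "(?B, ?P) \<in> ?S"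
      using R(2) b(1) by auto
    moreover have "?f (?B, ?P) = R"
      using b by (auto simp: insert_absorb)
    ultimately show "R \<in> ?f ` ?S"
      by (metis (no_types, lifting) image_eqI)
  qed
  ultimately have "card {P. partition_on (insert x A) P \<and> card P = Suc k} = card ?S"
    by (metis (no_types, lifting) card_image)
  also have "\<dots> = (\<Sum>B\<in>Pow A. card {P. partition_on (A - B) P \<and> card P = k})"
    using assms(1) by (subst card_SigmaI)
      (auto intro: finite_subset[OF _ finitely_many_partition_on])
  finally show ?thesis .
qed

text \<open>Grouping subsets by size turns the recurrence into a binomial convolution, the shape of
  a product of exponential generating functions.\<close>

lemma sum_Pow_card:
  fixes f :: "nat \<Rightarrow> real"
  assumes "finite A"
  shows "(\<Sum>B\<in>Pow A. f (card B)) = (\<Sum>j=0..card A. real (card A choose j) * f j)"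
proof -
  have "(\<Sum>B\<in>Pow A. f (card B)) = (\<Sum>j=0..card A. \<Sum>B\<in>{B \<in> Pow A. card B = j}. f (card B))"
    using assms by (intro sum.group[symmetric]) (auto simp: card_mono)
  also have "\<dots> = (\<Sum>j=0..card A. real (card A choose j) * f j)"
    using assms by (intro sum.cong) (auto simp: n_subsets)
  finally show ?thesis .
qed

text \<open>Induction on \<open>k\<close> for all finite \<open>A\<close> at once, because the step
  applies the hypothesis to every \<open>A' - B\<close>.\<close>

lemma card_partition_on_fps:
  assumes "finite A"
  shows "real (card {P. partition_on A P \<and> card P = k}) / fact (card A) =
    ((fps_exp 1 - 1) ^ k $ card A) / fact k"
  using assms
proof (induction k arbitrary: A)
  case 0
  \<comment> \<open>An infinite \<open>P\<close> would also have \<open>card P = 0\<close>;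
    finiteness of \<open>A\<close> excludes it.\<close>
  have "card P = 0 \<longleftrightarrow> P = {}" if "partition_on A P" for P
    using finite_elements[OF 0 that] by simp
  then have "{P. partition_on A P \<and> card P = 0} = (if A = {} then {{}} else {})"
    by (auto simp: partition_on_def)
  then show ?case
    using 0 by auto
next
  case (Suc k)
  show ?case
  proof (cases "A = {}")
    case True
    \<comment> \<open>Both sides are zero: \<open>fps_exp 1 - 1\<close> has no constant term, so
      neither has its \<open>Suc k\<close>-th power.\<close>
    then have empty: "{P. partition_on A P \<and> card P = Suc k} = {}"
      by (auto simp: partition_on_empty)
    show ?thesis
      unfolding empty by (simp add: True)
  next
    case False
    then obtain x A' where A: "A = insert x A'" "x \<notin> A'"
      by (meson Set.set_insert ex_in_conv)
    define n where "n = card A'"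
    define h where "h = (fps_exp 1 - 1 :: real fps)"
    have fin: "finite A'" and cA: "card A = Suc n"
      using Suc.prems A by (auto simp: n_def)
    have "real (card {P. partition_on A P \<and> card P = Suc k}) =
        (\<Sum>B\<in>Pow A'. fact (n - card B) * (h ^ k $ (n - card B)) / fact k)"
      unfolding A(1) card_partition_on_insert[OF fin A(2)] of_nat_sum
    proof (intro sum.cong refl)
      fix B assume "B \<in> Pow A'"
      then have "card (A' - B) = n - card B"
        using fin by (auto simp: n_def card_Diff_subset finite_subset)
      then show "real (card {P. partition_on (A' - B) P \<and> card P = k}) =
          fact (n - card B) * (h ^ k $ (n - card B)) / fact k"
        using Suc.IH[of "A' - B"] fin by (simp add: h_def field_simps)
    qed
    also have "\<dots> = (\<Sum>j=0..n. real (n choose j) * (fact (n - j) * (h ^ k $ (n - j)) / fact k))"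
      using sum_Pow_card[OF fin, of "\<lambda>j. fact (n - j) * (h ^ k $ (n - j)) / fact k"]
      by (simp add: n_def)
    \<comment> \<open>\<open>n choose j\<close> times \<open>fact (n - j)\<close> is
      \<open>fact n / fact j\<close>, and \<open>1 / fact j\<close> is a coefficient of
      \<open>fps_exp 1\<close>; a Cauchy product remains.\<close>
    also have "\<dots> = (\<Sum>j=0..n. fact n / fact k * (fps_exp 1 $ j * (h ^ k $ (n - j))))"
      by (intro sum.cong) (auto simp: binomial_fact)
    also have "\<dots> = fact n / fact k * ((fps_exp 1 * h ^ k) $ n)"
      by (simp add: fps_mult_nth sum_distrib_left)
    finally have count: "real (card {P. partition_on A P \<and> card P = Suc k}) =
        fact n / fact k * ((fps_exp 1 * h ^ k) $ n)" .
    \<comment> \<open>The derivative of \<open>h\<close> is \<open>fps_exp 1\<close>; coefficient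
      \<open>n\<close> of this identity determines coefficient \<open>Suc n\<close> of
      \<open>h ^ Suc k\<close>.\<close>
    have "fps_deriv (h ^ Suc k) = fps_const (real (Suc k)) * (fps_exp 1 * h ^ k)"
      by (subst fps_deriv_power) (simp add: h_def mult_ac)
    then have "fps_deriv (h ^ Suc k) $ n = real (Suc k) * ((fps_exp 1 * h ^ k) $ n)"
      by (simp only: fps_mult_left_const_nth)
    then have "real (Suc n) * (h ^ Suc k $ Suc n) = real (Suc k) * ((fps_exp 1 * h ^ k) $ n)"
      by (simp only: fps_deriv_nth Suc_eq_plus1)
    then have "(h ^ Suc k $ Suc n) / fact (Suc k) = ((fps_exp 1 * h ^ k) $ n) / (fact k * real (Suc n))"
      by (simp add: field_simps del: power_Suc of_nat_Suc)
    then show ?thesis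
      unfolding count cA h_def[symmetric] by (simp add: field_simps del: power_Suc of_nat_Suc)
  qed
qed

section \<open>Counting Fibonacci permutations\<close>

lemma finite_fibonacci_permutation: "finite {\<sigma>. fibonacci_permutation k \<sigma>}"
  by (rule finite_subset[OF _ finite_permutations[of "{1..k}"]]) (auto simp: fibonacci_permutation_def)

text \<open>A function that \<open>permutes\<close> a set is the identity outside it, so the very
  same function serves on both sides, without restriction or extension.\<close>

lemma fibonacci_permutation_fix_last:
  "fibonacci_permutation (Suc k) \<sigma> \<and> \<sigma> (Suc k) = Suc k \<longleftrightarrow> fibonacci_permutation k \<sigma>"
proof
  assume \<sigma>: "fibonacci_permutation (Suc k) \<sigma> \<and> \<sigma> (Suc k) = Suc k"
  then have "\<sigma> permutes {1..Suc k}"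
    by (simp add: fibonacci_permutation_def)
  then have "\<sigma> permutes {1..k}"
    by (rule permutes_superset) (use \<sigma> in \<open>auto simp: le_Suc_eq\<close>)
  with \<sigma> show "fibonacci_permutation k \<sigma>"
    by (auto simp: fibonacci_permutation_def)
next
  assume \<sigma>: "fibonacci_permutation k \<sigma>"
  then have "\<sigma> (Suc k) = Suc k"
    by (auto simp: fibonacci_permutation_def permutes_not_in)
  with \<sigma> show "fibonacci_permutation (Suc k) \<sigma> \<and> \<sigma> (Suc k) = Suc k"
    by (auto simp: fibonacci_permutation_def le_Suc_eq intro: permutes_subset)
qed

text \<open>If the last point moves, it can only go to its neighbour, and only that neighbour can be
  sent to the last point. So the last two points are exchanged, and the transposition undoes
  this.\<close>

lemma fibonacci_permutation_swap_last:
  assumes "fibonacci_permutation (Suc (Suc k)) \<sigma>" "\<sigma> (Suc (Suc k)) \<noteq> Suc (Suc k)"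
  shows "fibonacci_permutation k (\<sigma> \<circ> transpose (Suc k) (Suc (Suc k)))"
proof -
  let ?n = "Suc (Suc k)" and ?\<tau> = "\<sigma> \<circ> transpose (Suc k) (Suc (Suc k))"
  have near: "\<bar>int (\<sigma> i) - int i\<bar> \<le> 1" if "i \<in> {1..?n}" for i
    using assms(1) that by (auto simp: fibonacci_permutation_def)
  have perm: "\<sigma> permutes {1..?n}"
    using assms(1) by (simp add: fibonacci_permutation_def)
  have in_range: "\<sigma> i \<in> {1..?n}" if "i \<in> {1..?n}" for i
    using permutes_in_image[OF perm] that by blast
  have last: "\<sigma> ?n = Suc k"
    using near[of ?n] in_range[of ?n] assms(2) by auto
  obtain j where j: "\<sigma> j = ?n"
    using permutes_surj[OF perm] by (metis surjD)
  then have "j \<in> {1..?n}"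
    using permutes_in_image[OF perm, of j] by auto
  then have "j = Suc k"
    using near[of j] j assms(2) by (auto simp: le_Suc_eq)
  with j have prev: "\<sigma> (Suc k) = ?n"
    by simp
  have "?\<tau> permutes {1..?n}"
    by (intro permutes_compose permutes_swap_id perm) auto
  then have "?\<tau> permutes {1..k}"
    by (rule permutes_superset) (auto simp: last prev le_Suc_eq)
  moreover have "\<bar>int (?\<tau> i) - int i\<bar> \<le> 1" if "i \<in> {1..k}" for i
    using near[of i] that by (simp add: transpose_def)
  ultimately show ?thesis
    by (simp add: fibonacci_permutation_def)
qed

text \<open>Both new points are fixed by \<sigma>, so the composite exchanges them, moving each by
  exactly one.\<close>

lemma fibonacci_permutation_append_swap:
  assumes "fibonacci_permutation k \<sigma>"
  shows "fibonacci_permutation (Suc (Suc k)) (\<sigma> \<circ> transpose (Suc k) (Suc (Suc k)))"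
    and "(\<sigma> \<circ> transpose (Suc k) (Suc (Suc k))) (Suc (Suc k)) \<noteq> Suc (Suc k)"
proof -
  let ?n = "Suc (Suc k)" and ?\<tau> = "\<sigma> \<circ> transpose (Suc k) (Suc (Suc k))"
  have perm: "\<sigma> permutes {1..k}" and near: "\<forall>i\<in>{1..k}. \<bar>int (\<sigma> i) - int i\<bar> \<le> 1"
    using assms by (auto simp: fibonacci_permutation_def)
  have fixed: "\<sigma> (Suc k) = Suc k" "\<sigma> ?n = ?n"
    using perm by (auto simp: permutes_not_in)
  have "\<sigma> permutes {1..?n}"
    by (rule permutes_subset[OF perm]) auto
  then have "?\<tau> permutes {1..?n}"
    by (intro permutes_compose permutes_swap_id) auto
  moreover have "\<forall>i\<in>{1..?n}. \<bar>int (?\<tau> i) - int i\<bar> \<le> 1"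
    using near by (auto simp: transpose_def fixed le_Suc_eq)
  ultimately show "fibonacci_permutation ?n ?\<tau>"
    by (simp add: fibonacci_permutation_def)
  show "?\<tau> ?n \<noteq> ?n"
    by (simp add: fixed)
qed

lemma card_fibonacci_permutation_Suc_Suc:
  "card {\<sigma>. fibonacci_permutation (Suc (Suc k)) \<sigma>} =
    card {\<sigma>. fibonacci_permutation (Suc k) \<sigma>} + card {\<sigma>. fibonacci_permutation k \<sigma>}"
proof -
  let ?n = "Suc (Suc k)" and ?t = "\<lambda>\<sigma>. \<sigma> \<circ> transpose (Suc k) (Suc (Suc k))"
  let ?M = "{\<sigma>. fibonacci_permutation ?n \<sigma> \<and> \<sigma> ?n \<noteq> ?n}"
  have "{\<sigma>. fibonacci_permutation ?n \<sigma>} = {\<sigma>. fibonacci_permutation (Suc k) \<sigma>} \<union> ?M"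
    using fibonacci_permutation_fix_last[of "Suc k"] by blast
  moreover have "{\<sigma>. fibonacci_permutation (Suc k) \<sigma>} \<inter> ?M = {}"
    using fibonacci_permutation_fix_last[of "Suc k"] by blast
  moreover have "finite ?M"
    by (rule finite_subset[OF _ finite_fibonacci_permutation[of ?n]]) auto
  ultimately have "card {\<sigma>. fibonacci_permutation ?n \<sigma>} =
      card {\<sigma>. fibonacci_permutation (Suc k) \<sigma>} + card ?M"
    by (simp add: card_Un_disjoint finite_fibonacci_permutation)
  \<comment> \<open>Composing twice with a transposition changes nothing, so \<open>?t\<close> is
    its own inverse.\<close>
  moreover have "bij_betw ?t ?M {\<sigma>. fibonacci_permutation k \<sigma>}"
  proof (rule bij_betw_byWitness[where f' = ?t])
    show "?t ` ?M \<subseteq> {\<sigma>. fibonacci_permutation k \<sigma>}"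
      using fibonacci_permutation_swap_last by blast
    show "?t ` {\<sigma>. fibonacci_permutation k \<sigma>} \<subseteq> ?M"
      using fibonacci_permutation_append_swap by blast
  qed (simp_all add: comp_assoc)
  ultimately show ?thesis
    by (simp add: bij_betw_same_card)
qed

lemma golden_square:
  "golden_alpha * golden_alpha = golden_alpha + 1" "golden_beta * golden_beta = golden_beta + 1"
  by (simp_all add: golden_alpha_def golden_beta_def field_simps)

text \<open>Binet's formula. The exponent is shifted because the counts for \<open>k = 0\<close> and
  \<open>k = 1\<close> are both 1; the shift later yields the factors in front of the two
  exponentials.\<close>

lemma card_fibonacci_permutation:
  "real (card {\<sigma>. fibonacci_permutation k \<sigma>}) =
    (golden_alpha ^ Suc k - golden_beta ^ Suc k) / sqrt 5"
proof (induction k rule: induct_nat_012)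
  case 0
  have "{\<sigma>. fibonacci_permutation 0 \<sigma>} = {id}"
    by (auto simp: fibonacci_permutation_def)
  then show ?case
    by (simp add: golden_alpha_def golden_beta_def field_simps)
next
  case 1
  have "{\<sigma>. fibonacci_permutation 1 \<sigma>} = {id}"
    by (auto simp: fibonacci_permutation_def)
  then show ?case
    by (simp add: golden_square) (simp add: golden_alpha_def golden_beta_def field_simps)
next
  case (ge2 k)
  have fib_step: "x ^ Suc (Suc (Suc k)) = x ^ Suc (Suc k) + x ^ Suc k" if "x * x = x + 1" for x :: real
  proof -
    have "x ^ Suc (Suc (Suc k)) = (x * x) * x ^ Suc k"
      by simp
    also have "\<dots> = x ^ Suc (Suc k) + x ^ Suc k"
      unfolding that by (simp add: distrib_right)
    finally show ?thesis .
  qed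
  show ?case
    unfolding card_fibonacci_permutation_Suc_Suc of_nat_add ge2
      fib_step[OF golden_square(1)] fib_step[OF golden_square(2)]
    by (simp add: diff_divide_distrib add_divide_distrib del: power_Suc)
qed

section \<open>Arrangements as pairs of a block listing and a permutation\<close>

lemma nth_arrange: "i < length Bs \<Longrightarrow> arrange \<sigma> Bs ! i = Bs ! (\<sigma> (Suc i) - 1)"
  by (simp add: arrange_def nth_map_upt del: upt_Suc)

lemma set_arrange:
  assumes "\<sigma> permutes {1..length Bs}"
  shows "set (arrange \<sigma> Bs) = set Bs"
proof -
  have "set (arrange \<sigma> Bs) = (\<lambda>i. Bs ! (i - 1)) ` \<sigma> ` {1..length Bs}"
    by (simp add: arrange_def image_image atLeastLessThanSuc_atLeastAtMost del: upt_Suc)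
  also have "\<dots> = (\<lambda>i. Bs ! (i - 1)) ` Suc ` {0..<length Bs}"
    unfolding permutes_image[OF assms] image_Suc_atLeastLessThan atLeastLessThanSuc_atLeastAtMost
    by simp
  also have "\<dots> = set Bs"
    unfolding image_image by (auto simp: set_conv_nth)
  finally show ?thesis .
qed

lemma sorted_key_distinct:
  assumes "sorted_wrt (\<lambda>x y. f x < (f y :: 'b :: linorder)) xs"
  shows "sorted (map f xs)" "distinct (map f xs)"
  using assms strict_sorted_iff[of "map f xs"] by (simp_all add: sorted_wrt_map)

text \<open>Used with \<open>f = Min\<close>: a partition has at most one block listing.\<close>

lemma sorted_key_unique:
  assumes "sorted_wrt (\<lambda>x y. f x < (f y :: 'b :: linorder)) xs"
    and "sorted_wrt (\<lambda>x y. f x < f y) ys" and "set xs = set ys"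
  shows "xs = ys"
  using assms sorted_key_distinct[OF assms(1)] sorted_key_distinct[OF assms(2)]
  by (intro map_sorted_distinct_set_unique[of f]) (auto simp: distinct_map)

text \<open>An arrangement shows its set of blocks, hence the listing; since the listed blocks are
  distinct, their positions then reveal the permutation.\<close>

lemma inj_on_arrange:
  "inj_on (\<lambda>(Bs, \<sigma>). arrange \<sigma> Bs)
    (SIGMA Bs:{Bs. block_listing n Bs}. {\<sigma>. fibonacci_permutation (length Bs) \<sigma>})"
proof (rule inj_onI, clarify)
  fix Bs \<sigma> Cs \<tau>
  assume Bs: "block_listing n Bs" and Cs: "block_listing n Cs"
    and "fibonacci_permutation (length Bs) \<sigma>" "fibonacci_permutation (length Cs) \<tau>"
    and eq: "arrange \<sigma> Bs = arrange \<tau> Cs"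
  then have perm: "\<sigma> permutes {1..length Bs}" "\<tau> permutes {1..length Cs}"
    by (auto simp: fibonacci_permutation_def)
  have "set Bs = set Cs"
    using eq set_arrange perm by metis
  then have Bs_Cs: "Bs = Cs"
    using Bs Cs by (intro sorted_key_unique[of Min]) (auto simp: block_listing_def)
  have dist: "distinct Bs"
    using Bs sorted_key_distinct(2)[of Min Bs] by (auto simp: block_listing_def distinct_map)
  have "\<sigma> i = \<tau> i" for i
  proof (cases "i \<in> {1..length Bs}")
    case True
    then obtain j where j: "i = Suc j" "j < length Bs"
      by (cases i) auto
    \<comment> \<open>Both values are at least 1, so the truncated subtraction of 1 can be cancelled
      below.\<close>
    have "\<sigma> i \<in> {1..length Bs}" "\<tau> i \<in> {1..length Bs}"
      using True permutes_in_image[OF perm(1), of i] permutes_in_image[OF perm(2), of i] Bs_Cs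
      by simp_all
    moreover have "Bs ! (\<sigma> i - 1) = Bs ! (\<tau> i - 1)"
      using arg_cong[OF eq, of "\<lambda>xs. xs ! j"] j Bs_Cs by (simp add: nth_arrange)
    ultimately show ?thesis
      using nth_eq_iff_index_eq[OF dist, of "\<sigma> i - 1" "\<tau> i - 1"]
      by simp linarith
  next
    case False
    then show ?thesis
      using perm Bs_Cs by (simp add: permutes_not_in)
  qed
  with Bs_Cs show "Bs = Cs \<and> \<sigma> = \<tau>"
    by auto
qed

text \<open>Surjectivity comes from sorting the blocks by minimum; the order is strict because
  different blocks have different minima.\<close>

lemma bij_betw_set_block_listing:
  "bij_betw set {Bs. block_listing n Bs} {P. partition_on {1..n} P}"
proof (rule bij_betw_imageI)
  show "inj_on set {Bs. block_listing n Bs}"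
    by (rule inj_onI) (auto simp: block_listing_def intro: sorted_key_unique[of Min])
  show "set ` {Bs. block_listing n Bs} = {P. partition_on {1..n} P}"
  proof (intro equalityI subsetI)
    fix P assume "P \<in> {P. partition_on {1..n} P}"
    then have P: "partition_on {1..n} P" by simp
    have fin: "finite P" "\<And>B. B \<in> P \<Longrightarrow> finite B"
      using finite_elements[OF _ P] partition_onD1[OF P] finite_subset[of _ "{1..n}"] by blast+
    \<comment> \<open>Blocks are finite and non-empty, so each contains its \<open>Min\<close>; two
      disjoint blocks cannot share it.\<close>
    have "inj_on Min P"
    proof (rule inj_onI)
      fix B C assume BC: "B \<in> P" "C \<in> P" "Min B = Min C"
      then have "Min B \<in> B" "Min B \<in> C"
        using fin(2) partition_onD3[OF P] by (metis Min_in)+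
      then show "B = C"
        using BC partition_onD2[OF P] by (auto simp: pairwise_def disjnt_iff)
    qed
    moreover obtain xs where xs: "set xs = P" "distinct xs"
      using finite_distinct_list[OF fin(1)] by auto
    ultimately have "sorted_wrt (<) (map Min (sort_key Min xs))"
      by (simp add: strict_sorted_iff distinct_map)
    then have "block_listing n (sort_key Min xs)"
      using P xs by (simp add: block_listing_def sorted_wrt_map)
    moreover have "set (sort_key Min xs) = P"
      using xs by simp
    ultimately show "P \<in> set ` {Bs. block_listing n Bs}"
      by blast
  qed (auto simp: block_listing_def)
qed

text \<open>The number of admissible permutations depends only on the number of blocks, so the pairs
  can be grouped by it.\<close>

lemma fibonacci_fubini_sum:
  "fibonacci_fubini n =
    (\<Sum>k=0..n. card {P. partition_on {1..n} P \<and> card P = k} * card {\<sigma>. fibonacci_permutation k \<sigma>})"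
proof -
  let ?S = "SIGMA Bs:{Bs. block_listing n Bs}. {\<sigma>. fibonacci_permutation (length Bs) \<sigma>}"
  let ?w = "\<lambda>k. card {\<sigma>. fibonacci_permutation k \<sigma>}"
  let ?\<P> = "{P. partition_on {1..n} P}"
  have finP: "finite ?\<P>"
    by (rule finitely_many_partition_on) simp
  then have fin: "finite {Bs. block_listing n Bs}"
    using bij_betw_finite[OF bij_betw_set_block_listing] by blast
  \<comment> \<open>This bounds the range of \<open>k\<close>: each block contributes at least 1 to
    the total size \<open>n\<close>.\<close>
  have card_le: "card P \<le> n" if "partition_on {1..n} P" for P
  proof -
    have fin: "finite B" if "B \<in> P" for B
      using that partition_onD1[OF \<open>partition_on {1..n} P\<close>] finite_subset[of B "{1..n}"] by blast
    have "card P = (\<Sum>B\<in>P. 1)"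
      by simp
    also have "\<dots> \<le> (\<Sum>B\<in>P. card B)"
    proof (rule sum_mono)
      fix B assume "B \<in> P"
      then show "1 \<le> card B"
        using fin[of B] partition_onD3[OF that] by (auto simp: Suc_le_eq card_gt_0_iff)
    qed
    also have "\<dots> = n"
      using product_partition[OF that fin] by simp
    finally show ?thesis .
  qed
  have "fibonacci_ordered_partitions n = (\<lambda>(Bs, \<sigma>). arrange \<sigma> Bs) ` ?S"
    by (auto simp: fibonacci_ordered_partitions_def)
  then have "fibonacci_fubini n = card ?S"
    by (simp only: fibonacci_fubini_def card_image[OF inj_on_arrange])
  also have "\<dots> = (\<Sum>Bs\<in>{Bs. block_listing n Bs}. ?w (length Bs))"
    using fin by (simp add: card_SigmaI finite_fibonacci_permutation)
  \<comment> \<open>Expressing the weight through \<open>set Bs\<close> lets the sum be carried over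
    to partitions.\<close>
  also have "\<dots> = (\<Sum>Bs\<in>{Bs. block_listing n Bs}. ?w (card (set Bs)))"
  proof (intro sum.cong refl)
    fix Bs assume "Bs \<in> {Bs. block_listing n Bs}"
    then have "distinct Bs"
      using sorted_key_distinct(2)[of Min Bs] by (auto simp: block_listing_def distinct_map)
    then show "?w (length Bs) = ?w (card (set Bs))"
      by (simp add: distinct_card)
  qed
  also have "\<dots> = (\<Sum>P\<in>?\<P>. ?w (card P))"
    using sum.reindex_bij_betw[OF bij_betw_set_block_listing, of "\<lambda>P. ?w (card P)"] .
  also have "\<dots> = (\<Sum>k=0..n. \<Sum>P\<in>{P\<in>?\<P>. card P = k}. ?w (card P))"
    using card_le finP by (intro sum.group[symmetric]) auto
  also have "\<dots> = (\<Sum>k=0..n. card {P. partition_on {1..n} P \<and> card P = k} * ?w k)"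
    by (intro sum.cong) auto
  finally show ?thesis .
qed

theorem theorem3:
  "fibonacci_fubini_egf =
     fps_const (1 / sqrt 5) *
       (fps_const golden_alpha * (fps_exp 1 oo ((fps_exp 1 - 1) * fps_const golden_alpha))
        - fps_const golden_beta * (fps_exp 1 oo ((fps_exp 1 - 1) * fps_const golden_beta)))"
proof (rule fps_ext)
  fix n
  let ?h = "fps_exp 1 - 1 :: real fps"
  \<comment> \<open>Coefficient \<open>n\<close> of a composition involves only powers up to
    \<open>n\<close>, the same range as the number of blocks.\<close>
  have comp: "(fps_exp 1 oo (?h * fps_const c)) $ n = (\<Sum>k=0..n. c ^ k * (?h ^ k $ n) / fact k)"
    for c :: real
    by (simp add: fps_compose_nth power_mult_distrib fps_const_power mult_ac)
  \<comment> \<open>Writing \<open>n\<close> as \<open>card {1..n}\<close> inside the factorial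
    brings each term into the form of \<open>card_partition_on_fps\<close>.\<close>
  have "fibonacci_fubini_egf $ n =
      (\<Sum>k=0..n. real (card {P. partition_on {1..n} P \<and> card P = k}) / fact (card {1..n}) *
        real (card {\<sigma>. fibonacci_permutation k \<sigma>}))"
    by (simp add: fibonacci_fubini_egf_def fibonacci_fubini_sum sum_divide_distrib)
  also have "\<dots> = (\<Sum>k=0..n. (?h ^ k $ n) / fact k *
      ((golden_alpha ^ Suc k - golden_beta ^ Suc k) / sqrt 5))"
    unfolding card_partition_on_fps[OF finite_atLeastAtMost] card_fibonacci_permutation by simp
  also have "\<dots> = 1 / sqrt 5 *
      (golden_alpha * (\<Sum>k=0..n. golden_alpha ^ k * (?h ^ k $ n) / fact k)
       - golden_beta * (\<Sum>k=0..n. golden_beta ^ k * (?h ^ k $ n) / fact k))"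
    unfolding sum_distrib_left sum_subtractf[symmetric]
    by (intro sum.cong) (simp_all add: field_simps)
  finally show "fibonacci_fubini_egf $ n = (fps_const (1 / sqrt 5) *
       (fps_const golden_alpha * (fps_exp 1 oo (?h * fps_const golden_alpha))
        - fps_const golden_beta * (fps_exp 1 oo (?h * fps_const golden_beta)))) $ n"
    by (simp only: comp fps_mult_left_const_nth fps_sub_nth)
qed

end
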